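(* There exist $\rho>0$ and an infinite sequence $\{B_n\}_{n\in\mathbb{N}}$ of compact connected sets in $\mathbb{R}^2$, each with condition number at least $\rho$, such that $\{B_n\}_{n\in\mathbb{N}}$ satisfies the $(\aleph_0,2)$-property with respect to points, but there is no finite set of points in $\mathbb{R}^2$ meeting every $B_n$.
   Context: For a set $S\subseteq\mathbb{R}^2$, $R_S$ is the radius of the smallest closed disk containing $S$, $r_S$ is the radius of the largest closed disk contained in $S$, and the condition number is $\sigma(S)=r_S/R_S$. A family satisfies the $(\aleph_0,2)$-property with respect to points if among every infinite subsequence of its members there are two that intersect. *)

theory Defs
  imports "HOL-Analysis.Analysis"
begin

definition circumradius :: "(real ^ 2) set \<Rightarrow> real" where
  "circumradius S = Inf {r. 0 \<le> r \<and> (\<exists>c. S \<subseteq> cball c r)}"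

text \<open>The guard \<open>0 \<le> r\<close> in the next definition is needed because \<^term>\<open>cball c r\<close> is empty for
  negative \<open>r\<close>.\<close>

definition inradius :: "(real ^ 2) set \<Rightarrow> real" where
  "inradius S = Sup {r. 0 \<le> r \<and> (\<exists>c. cball c r \<subseteq> S)}"

text \<open>The empty set and singletons have circumradius 0 and hence, by division by zero, condition
  number 0.\<close>

definition condition_number :: "(real ^ 2) set \<Rightarrow> real" where
  "condition_number S = inradius S / circumradius S"

definition aleph0_2_property :: "(nat \<Rightarrow> (real ^ 2) set) \<Rightarrow> bool" where
  "aleph0_2_property B \<longleftrightarrow>
     (\<forall>f :: nat \<Rightarrow> nat. strict_mono f \<longrightarrow> (\<exists>i j. i \<noteq> j \<and> B (f i) \<inter> B (f j) \<noteq> {}))"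

text \<open>For nonempty compact sets the infimum and the supremum above are attained, so they are
  the radii of a smallest enclosing and of a largest enclosed closed disk.\<close>

lemma circumradius_attained:
  fixes S :: "(real ^ 2) set"
  assumes "compact S" "S \<noteq> {}"
  shows "\<exists>c. S \<subseteq> cball c (circumradius S)"
    and "0 \<le> r \<Longrightarrow> S \<subseteq> cball c r \<Longrightarrow> circumradius S \<le> r"
proof -
  let ?T = "{r. 0 \<le> r \<and> (\<exists>c. S \<subseteq> cball c r)}"
  show low: "circumradius S \<le> r" if "0 \<le> r" "S \<subseteq> cball c r" for r c
    unfolding circumradius_def
    by (rule cInf_lower) (use that in \<open>auto intro!: bdd_belowI[of _ 0]\<close>)
  obtain x0 where x0: "x0 \<in> S" using assms by auto
  obtain e where "\<forall>y\<in>S. dist x0 y \<le> e"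
    using compact_imp_bounded[OF assms(1)] bounded_any_center by blast
  moreover define R where "R = max e 1"
  ultimately have R: "R > 0" "S \<subseteq> cball x0 R" by (auto simp: le_max_iff_disj)
  define K where "K = (cball x0 R \<times> {0..R}) \<inter> (\<Inter>x\<in>S. {p. dist (fst p) x \<le> snd p})"
  have K: "compact K"
    unfolding K_def
    by (intro compact_Int_closed compact_Times compact_cball compact_Icc closed_INT ballI
        closed_Collect_le continuous_intros)
  have "(x0, R) \<in> K" using R by (auto simp: K_def)
  then obtain p where p: "p \<in> K" "\<And>q. q \<in> K \<Longrightarrow> snd p \<le> snd q"
    using continuous_attains_inf[OF K _ continuous_on_snd[OF continuous_on_id]] by blast
  have pT: "0 \<le> snd p" "S \<subseteq> cball (fst p) (snd p)" using p(1) by (auto simp: K_def)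
  have "snd p \<le> r" if r: "r \<in> ?T" for r
  proof (cases "r \<le> R")
    case True
    from r obtain c where c: "0 \<le> r" "S \<subseteq> cball c r" by auto
    have "dist x0 c \<le> R" using c x0 True by (auto simp: dist_commute)
    then have "(c, r) \<in> K" using c True by (auto simp: K_def)
    then show ?thesis using p(2) by fastforce
  next
    case False
    then show ?thesis using p(1) by (auto simp: K_def)
  qed
  then have "snd p \<le> circumradius S"
    unfolding circumradius_def by (intro cInf_greatest) (use pT in auto)
  with low[OF pT] have "circumradius S = snd p" by simp
  with pT show "\<exists>c. S \<subseteq> cball c (circumradius S)" by auto
qed

lemma inradius_attained:
  fixes S :: "(real ^ 2) set"
  assumes "compact S" "S \<noteq> {}"
  shows "\<exists>c. cball c (inradius S) \<subseteq> S"
    and "0 \<le> r \<Longrightarrow> cball c r \<subseteq> S \<Longrightarrow> r \<le> inradius S"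
proof -
  let ?T = "{r. 0 \<le> r \<and> (\<exists>c. cball c r \<subseteq> S)}"
  have ne: "- S \<noteq> {}"
    using compact_imp_bounded[OF assms(1)] not_bounded_UNIV[where 'a = "real ^ 2"]
    by (metis Compl_empty_eq double_compl)
  obtain m where m: "m \<in> S" "\<And>c. c \<in> S \<Longrightarrow> infdist c (- S) \<le> infdist m (- S)"
    using continuous_attains_sup[OF assms continuous_on_infdist[OF continuous_on_id]] by blast
  have up: "r \<le> infdist m (- S)" if "0 \<le> r" "cball c r \<subseteq> S" for r c
  proof -
    have "r \<le> infdist c (- S)"
      unfolding infdist_notempty[OF ne]
      by (rule cINF_greatest[OF ne]) (use that in \<open>force simp: not_le[symmetric]\<close>)
    also have "c \<in> S" using that by auto
    then have "infdist c (- S) \<le> infdist m (- S)" by (rule m(2))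
    finally show ?thesis .
  qed
  have "cball m (infdist m (- S)) \<subseteq> S"
  proof (cases "infdist m (- S) = 0")
    case True
    then show ?thesis using m(1) by simp
  next
    case False
    have "ball m (infdist m (- S)) \<subseteq> S"
      using infdist_le[of _ "- S" m] by force
    then have "closure (ball m (infdist m (- S))) \<subseteq> S"
      using compact_imp_closed[OF assms(1)] by (rule closure_minimal)
    then show ?thesis
      using False infdist_nonneg[of m "- S"] by (simp add: closure_ball)
  qed
  then have "infdist m (- S) \<in> ?T" by (auto simp: infdist_nonneg)
  moreover from this have "inradius S = infdist m (- S)"
    unfolding inradius_def by (intro cSup_eq_maximum) (use up in auto)
  ultimately show "\<exists>c. cball c (inradius S) \<subseteq> S"
    and "0 \<le> r \<Longrightarrow> cball c r \<subseteq> S \<Longrightarrow> r \<le> inradius S"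
    using up by auto
qed

end

theory Submission
  imports Defs
begin

text \<open>Take crosses made of a horizontal segment at height \<open>1/m\<close> and a vertical segment at abscissa
  \<open>1/m\<close>. Any two of them meet, but a point lies on at most two of them. Continuing the horizontal
  arm to a disk of radius \<open>m\<close> centred at abscissa \<open>3m\<close> makes the sets fat, and since the disks run
  off to infinity, a point still lies in only finitely many of the sets.\<close>

definition disk_cross :: "real \<Rightarrow> (real ^ 2) set" where
  "disk_cross m = cbox (vector [0, 1/m]) (vector [3*m, 1/m])
     \<union> cbox (vector [1/m, 0]) (vector [1/m, 1]) \<union> cball (vector [3*m, 1/m]) m"

lemma mem_cbox_vector_2:
  fixes x :: "real ^ 2"
  shows "x \<in> cbox (vector [a, b]) (vector [c, d]) \<longleftrightarrow> a \<le> x$1 \<and> x$1 \<le> c \<and> b \<le> x$2 \<and> x$2 \<le> d"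
  by (auto simp: mem_box_cart forall_2)

lemma compact_disk_cross: "compact (disk_cross m)"
  by (simp add: disk_cross_def compact_Un compact_cbox)

lemma connected_disk_cross:
  assumes "1 \<le> m"
  shows "connected (disk_cross m)"
proof -
  let ?H = "cbox (vector [0, 1/m]) (vector [3*m, 1/m]) :: (real ^ 2) set"
  let ?V = "cbox (vector [1/m, 0]) (vector [1/m, 1]) :: (real ^ 2) set"
  have "1/m \<le> 1"
    using assms by simp
  then have "1/m \<le> 3*m"
    using assms by linarith
  \<comment> \<open>The horizontal arm links the other two pieces: it contains the crossing point
    and the centre of the disk.\<close>
  then have "vector [1/m, 1/m] \<in> ?H \<inter> ?V" "vector [3*m, 1/m] \<in> ?H \<inter> cball (vector [3*m, 1/m]) m"
    using assms by (simp_all add: mem_cbox_vector_2)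
  then show ?thesis
    unfolding disk_cross_def
    by (intro connected_Un convex_connected convex_box convex_cball) blast+
qed

text \<open>A point on either arm is off the centre by at most \<open>3*m\<close> horizontally and
  at most \<open>1 \<le> m\<close> vertically, and the l1 norm bounds the Euclidean one.\<close>

lemma disk_cross_subset_cball:
  assumes "1 \<le> m"
  shows "disk_cross m \<subseteq> cball (vector [3*m, 1/m]) (4*m)"
proof
  fix x assume x: "x \<in> disk_cross m"
  have m: "0 < 1/m" "1/m \<le> 1"
    using assms by simp_all
  let ?c = "vector [3*m, 1/m] :: real ^ 2"
  have "norm (?c - x) \<le> \<bar>3*m - x$1\<bar> + \<bar>1/m - x$2\<bar>"
    using norm_le_l1_cart[of "?c - x"] by (simp add: sum_2)
  moreover have "\<bar>3*m - x$1\<bar> + \<bar>1/m - x$2\<bar> \<le> 4*m" if "x \<notin> cball ?c m"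
  proof -
    have "0 \<le> x$1 \<and> x$1 \<le> 3*m \<and> x$2 = 1/m \<or> x$1 = 1/m \<and> 0 \<le> x$2 \<and> x$2 \<le> 1"
      using x that unfolding disk_cross_def Un_iff mem_cbox_vector_2 by linarith
    then show ?thesis
      using m assms by linarith
  qed
  ultimately have "dist ?c x \<le> 4*m" if "x \<notin> cball ?c m"
    using that by (fastforce simp: dist_norm)
  then show "x \<in> cball ?c (4*m)"
    using assms by fastforce
qed

lemma condition_number_disk_cross:
  assumes "1 \<le> m"
  shows "1/4 \<le> condition_number (disk_cross m)"
proof -
  let ?S = "disk_cross m" and ?c = "vector [3*m, 1/m] :: real ^ 2"
  have sub: "cball ?c m \<subseteq> ?S"
    by (auto simp: disk_cross_def)
  then have ne: "?S \<noteq> {}"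
    using assms by auto
  have r: "m \<le> inradius ?S"
    using inradius_attained(2)[OF compact_disk_cross ne _ sub] assms by simp
  have R: "circumradius ?S \<le> 4*m"
    using circumradius_attained(2)[OF compact_disk_cross ne _ disk_cross_subset_cball] assms by simp
  \<comment> \<open>The bounds \<open>m\<close> and \<open>4*m\<close> give the ratio 1/4 only if
    the circumradius is nonzero, since division by zero would yield 0. An enclosing disk contains
    the disk of radius \<open>m\<close>, which forces positivity.\<close>
  obtain d where "?S \<subseteq> cball d (circumradius ?S)"
    using circumradius_attained(1)[OF compact_disk_cross ne] by blast
  with sub have "cball ?c m \<subseteq> cball d (circumradius ?S)"
    by blast
  then have "dist ?c d + m \<le> circumradius ?S"
    using assms by (simp add: cball_subset_cball_iff)
  then have "0 < circumradius ?S"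
    using assms zero_le_dist[of ?c d] by linarith
  with r R show ?thesis
    by (simp add: condition_number_def field_simps)
qed

text \<open>The vertical arm of the first set crosses the horizontal arm of the second at
  \<open>(1/m, 1/k)\<close>.\<close>

lemma disk_cross_Int_nonempty:
  assumes "1 \<le> m" "1 \<le> k"
  shows "disk_cross m \<inter> disk_cross k \<noteq> {}"
proof -
  have "1/m \<le> 1" "1/k \<le> 1"
    using assms by simp_all
  then have "1/m \<le> 3*k"
    using assms by linarith
  then have "vector [1/m, 1/k] \<in> disk_cross m \<inter> disk_cross k"
    using assms by (simp add: disk_cross_def mem_cbox_vector_2)
  then show ?thesis
    by blast
qed

text \<open>The bound depends on \<open>x\<close> alone. Each summand serves one piece: an arm
  determines \<open>m\<close> as the reciprocal of a coordinate, and the disk lies at abscissa at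
  least \<open>2*m\<close>. If a coordinate is 0, its reciprocal is 0 by convention, which is
  harmless because no point of the corresponding arm has that coordinate 0.\<close>

lemma disk_cross_parameter_le:
  assumes "0 < m" "x \<in> disk_cross m"
  shows "m \<le> \<bar>x$1\<bar> + \<bar>1 / x$1\<bar> + \<bar>1 / x$2\<bar>"
proof -
  consider "x$2 = 1/m" | "x$1 = 1/m" | "x \<in> cball (vector [3*m, 1/m]) m"
    using assms by (auto simp: disk_cross_def mem_cbox_vector_2)
  then show ?thesis
  proof cases
    case 3
    then have "\<bar>3*m - x$1\<bar> \<le> m"
      using component_le_norm_cart[of "vector [3*m, 1/m] - x" 1] by (simp add: dist_norm)
    then have "m \<le> \<bar>x$1\<bar>"
      using assms by linarith
    then show ?thesis
      by (smt (verit) abs_ge_zero)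
  qed (use assms in auto)
qed

lemma finite_disk_crosses_containing: "finite {n. x \<in> disk_cross (real (Suc n))}"
proof -
  let ?b = "\<bar>x$1\<bar> + \<bar>1 / x$1\<bar> + \<bar>1 / x$2\<bar>"
  have "n \<le> nat \<lceil>?b\<rceil>" if "x \<in> disk_cross (real (Suc n))" for n
    using disk_cross_parameter_le[OF _ that] by linarith
  then show ?thesis
    by (intro finite_subset[OF _ finite_atMost[of "nat \<lceil>?b\<rceil>"]]) auto
qed

theorem theorem12:
  "\<exists>\<rho> > 0. \<exists>B :: nat \<Rightarrow> (real ^ 2) set.
     (\<forall>n. compact (B n) \<and> connected (B n) \<and> \<rho> \<le> condition_number (B n)) \<and>
     aleph0_2_property B \<and>
     \<not> (\<exists>P :: (real ^ 2) set. finite P \<and> (\<forall>n. P \<inter> B n \<noteq> {}))"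
proof (intro exI conjI allI)
  let ?B = "\<lambda>n. disk_cross (real (Suc n))"
  show "0 < (1/4 :: real)"
    by simp
  show "compact (?B n)" "connected (?B n)" "1/4 \<le> condition_number (?B n)" for n
    by (intro compact_disk_cross connected_disk_cross condition_number_disk_cross; simp)+
  have "?B i \<inter> ?B j \<noteq> {}" for i j
    by (rule disk_cross_Int_nonempty) simp_all
  then show "aleph0_2_property ?B"
    unfolding aleph0_2_property_def by (meson zero_neq_one)
  show "\<not> (\<exists>P. finite P \<and> (\<forall>n. P \<inter> ?B n \<noteq> {}))"
  proof
    assume "\<exists>P. finite P \<and> (\<forall>n. P \<inter> ?B n \<noteq> {})"
    then obtain P where P: "finite P" "\<And>n. P \<inter> ?B n \<noteq> {}"
      by blast
    \<comment> \<open>A finite piercing set would cover all indices by finitely many finite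
      sets.\<close>
    have "(UNIV :: nat set) \<subseteq> (\<Union>x\<in>P. {n. x \<in> ?B n})"
      using P(2) by blast
    then show False
      using P(1) finite_disk_crosses_containing infinite_UNIV_nat
      by (metis (no_types, lifting) finite_UN_I finite_subset)
  qed
qed

end
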